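(* Let $\mathbb{F}$ be a field of characteristic not two and let $\eta\in\mathbb{F}$, $\eta\neq 0,1$. Let $A$ be an axial algebra of Jordan type $\eta$ over $\mathbb{F}$ generated by primitive axes $a$, $b$, $c$. Then $A$ is the linear span of $a$, $b$, $c$, $ab$, $bc$, $ac$, $(ab)c$, $(ac)b$, $(bc)a$; in particular $\dim A\leq 9$. Furthermore, if $\alpha=\varphi_a(b)$, $\beta=\varphi_b(c)$, $\gamma=\varphi_c(a)$ and $\psi=\varphi_a(bc)$, then (i) $A_0(a)$ is the linear span of $ab-\alpha(1-\eta)a-\eta b$, $\ ac-\gamma(1-\eta)a-\eta c$, $\ a(bc)-\eta\, bc-\psi(1-\eta)a$, and $b(ac)+c(ab)-\eta\, bc-\eta\alpha c-\eta\gamma b-(2\alpha\gamma+\eta\psi-4\eta\alpha\gamma)a$; (ii) $A_\eta(a)$ is the linear span of $b(ac)-c(ab)$, $\ ab-\alpha a$, $\ ac-\gamma a$, $\ a(bc)-\psi a$; (iii) either $\eta=\frac12$ or $\alpha(\beta-\gamma)(\eta-2\alpha)=\beta(\gamma-\alpha)(\eta-2\beta)=\gamma(\alpha-\beta)(\eta-2\gamma)=0$.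
   Context: Algebras are not assumed associative. For a commutative $\mathbb{F}$-algebra $A$, $a\in A$ and $\lambda\in\mathbb{F}$, let $ad_a: x\mapsto xa$ and let $A_\lambda(a)$ be the $\lambda$-eigenspace of $ad_a$ (possibly zero). Let $\eta\in\mathbb{F}\setminus\{0,1\}$. A commutative $\mathbb{F}$-algebra $A$ is an axial algebra of Jordan type $\eta$ if it is generated (as an algebra) by a set $X$ of idempotents (called axes) such that for each $a\in X$: (1) the minimal polynomial of $ad_a$ divides $(x-1)x(x-\eta)$, so $A=A_1(a)\oplus A_0(a)\oplus A_\eta(a)$; (2) $A_1(a)A_1(a)\subseteq A_1(a)$, $A_0(a)A_0(a)\subseteq A_0(a)$, $A_1(a)A_0(a)=\{0\}$, $(A_0(a)+A_1(a))A_\eta(a)\subseteq A_\eta(a)$, $A_\eta(a)A_\eta(a)\subseteq A_0(a)+A_1(a)$. An axis $a$ is primitive if $A_1(a)$ is 1-dimensional, i.e. $A_1(a)=\langle a\rangle$. "Generated by primitive axes $a,b,c$" means one may take $X=\{a,b,c\}$ with all three axes primitive. For a primitive axis $a$ and $y\in A$, $\varphi_a(y)\in\mathbb{F}$ is the scalar such that the projection of $y$ on $A_1(a)$ along $A_0(a)\oplus A_\eta(a)$ equals $\varphi_a(y)a$. *)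

theory Defs
  imports
    "HOL-Computational_Algebra.Polynomial"
    "HOL-Library.Set_Algebras"
begin

locale comm_algebra = vector_space scale
  for scale :: "'k::field \<Rightarrow> 'a::ab_group_add \<Rightarrow> 'a"  (infixr \<open>*s\<close> 75) +
  fixes mult :: "'a \<Rightarrow> 'a \<Rightarrow> 'a"  (infixl \<open>\<cdot>\<close> 70)
  assumes mult_commute: "x \<cdot> y = y \<cdot> x"
    and mult_add_left: "(x + y) \<cdot> z = x \<cdot> z + y \<cdot> z"
    and mult_scale_left: "(t *s x) \<cdot> y = t *s (x \<cdot> y)"
begin

definition subalgebra :: "'a set \<Rightarrow> bool"
  where "subalgebra S \<longleftrightarrow> subspace S \<and> (\<forall>x\<in>S. \<forall>y\<in>S. x \<cdot> y \<in> S)"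

definition generated_by :: "'a set \<Rightarrow> bool"
  where "generated_by X \<longleftrightarrow> subalgebra hull X = UNIV"

definition idempotent :: "'a \<Rightarrow> bool"
  where "idempotent a \<longleftrightarrow> a \<cdot> a = a"

definition ad :: "'a \<Rightarrow> 'a \<Rightarrow> 'a"
  where "ad a x = x \<cdot> a"

definition eigenspace :: "'a \<Rightarrow> 'k \<Rightarrow> 'a set"
  where "eigenspace a l = {x. ad a x = l *s x}"

text \<open>The value \<open>p(T)\<close> of a polynomial at an operator, applied to a vector.\<close>

definition poly_op :: "'k poly \<Rightarrow> ('a \<Rightarrow> 'a) \<Rightarrow> 'a \<Rightarrow> 'a"
  where "poly_op p T x = (\<Sum>i\<le>degree p. coeff p i *s ((T ^^ i) x))"

definition annihilates :: "'k poly \<Rightarrow> ('a \<Rightarrow> 'a) \<Rightarrow> bool"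
  where "annihilates p T \<longleftrightarrow> (\<forall>x. poly_op p T x = 0)"

text \<open>The space may be infinite-dimensional, so \<open>T\<close> need not have a minimal polynomial;
  hence a predicate.\<close>

definition minimal_polynomial :: "('a \<Rightarrow> 'a) \<Rightarrow> 'k poly \<Rightarrow> bool"
  where "minimal_polynomial T m \<longleftrightarrow>
    lead_coeff m = 1 \<and> annihilates m T \<and>
    (\<forall>q. q \<noteq> 0 \<longrightarrow> annihilates q T \<longrightarrow> degree m \<le> degree q)"

definition prod_set :: "'a set \<Rightarrow> 'a set \<Rightarrow> 'a set"
  where "prod_set U V = {u \<cdot> v | u v. u \<in> U \<and> v \<in> V}"

definition jordan_axis :: "'k \<Rightarrow> 'a \<Rightarrow> bool"
  where "jordan_axis \<eta> a \<longleftrightarrow>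
    idempotent a \<and>
    (\<exists>m. minimal_polynomial (ad a) m \<and> m dvd [:-1, 1:] * [:0, 1:] * [:-\<eta>, 1:]) \<and>
    prod_set (eigenspace a 1) (eigenspace a 1) \<subseteq> eigenspace a 1 \<and>
    prod_set (eigenspace a 0) (eigenspace a 0) \<subseteq> eigenspace a 0 \<and>
    prod_set (eigenspace a 1) (eigenspace a 0) = {0} \<and>
    prod_set (eigenspace a 0 + eigenspace a 1) (eigenspace a \<eta>) \<subseteq> eigenspace a \<eta> \<and>
    prod_set (eigenspace a \<eta>) (eigenspace a \<eta>) \<subseteq> eigenspace a 0 + eigenspace a 1"

text \<open>\<open>dim\<close> is \<open>0\<close> on infinite-dimensional spaces, so the condition below does say
  that the 1-eigenspace is a line. In particular \<open>a \<noteq> 0\<close> if \<open>a\<close> is an idempotent.\<close>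

definition primitive :: "'a \<Rightarrow> bool"
  where "primitive a \<longleftrightarrow> dim (eigenspace a 1) = 1"

definition axial_jordan_generated :: "'k \<Rightarrow> 'a set \<Rightarrow> bool"
  where "axial_jordan_generated \<eta> X \<longleftrightarrow> generated_by X \<and> (\<forall>a\<in>X. jordan_axis \<eta> a)"

definition axis_proj :: "'k \<Rightarrow> 'a \<Rightarrow> 'a \<Rightarrow> 'a"
  where "axis_proj \<eta> a y =
    (THE p. p \<in> eigenspace a 1 \<and> y - p \<in> eigenspace a 0 + eigenspace a \<eta>)"

text \<open>Well defined only if \<open>a\<close> is a primitive axis and \<open>\<eta> \<noteq> 0, 1\<close>.\<close>

definition axis_phi :: "'k \<Rightarrow> 'a \<Rightarrow> 'a \<Rightarrow> 'k"
  where "axis_phi \<eta> a y = (THE t. axis_proj \<eta> a y = t *s a)"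

end

end

theory Submission
  imports Defs
begin

text \<open>
  Relative to a primitive axis \<open>a\<close> write \<open>x = \<phi>\<^sub>a(x) a + x\<^sub>0 + x\<^sub>\<eta>\<close>. The components and \<open>\<phi>\<^sub>a\<close> are read off
  \<open>a x\<close> and \<open>a (a x) = \<eta> a x + \<phi>\<^sub>a(x) (1 - \<eta>) a\<close>. For arbitrary \<open>x\<close>, \<open>y\<close> the fusion rules applied to
  \<open>x\<^sub>0 y\<^sub>0 - x\<^sub>\<eta> y\<^sub>\<eta>\<close> and to \<open>x\<^sub>0 y\<^sub>\<eta> - x\<^sub>\<eta> y\<^sub>0\<close> show that \<open>a\<close> maps the span of the nine products
  into itself. The elements \<open>n\<close> with \<open>n S \<subseteq> S\<close>, where \<open>S\<close> is this span, are stable under multiplication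
  by \<open>a\<close>, \<open>b\<close> and \<open>c\<close>, so they include all nine products and \<open>S\<close> is a subalgebra. The two
  eigenspaces are then the projections of the nine products. For the last claim,
  \<open>b\<^sub>\<eta> b\<^sub>\<eta>\<close> lies in the sum of the 0- and 1-eigenspaces of \<open>a\<close>, which for \<open>\<eta> \<noteq> 1/2\<close> forces
  \<open>\<alpha> = 0\<close>, \<open>2 \<alpha> = \<eta>\<close> or \<open>a = b\<close>.
\<close>

section \<open>Linear maps and dimension on a finite spanning set\<close>

lemma (in vector_space) linear_image_in_span:
  assumes "\<And>x y. f (x + y) = f x + f y" "\<And>t x. f (t *s x) = t *s f x"
    and "\<And>g. g \<in> G \<Longrightarrow> f g \<in> span Z" and "x \<in> span G"
  shows "f x \<in> span Z"
  using assms(4)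
proof (induction rule: span_induct_alt)
  case base
  show ?case using assms(2)[of 0 0] by (simp add: span_zero)
next
  case (step t g x)
  then show ?case by (simp add: assms(1,2) span_add span_scale assms(3))
qed

text \<open>The first conclusion gives the second its content, since \<open>dim\<close> is 0 on
  infinite-dimensional spaces.\<close>

lemma (in vector_space) finite_span_imp:
  assumes "finite G" "span G = UNIV"
  shows "\<exists>B. finite_dimensional_vector_space scale B" "dim UNIV \<le> card G"
proof -
  obtain B where B: "B \<subseteq> G" "independent B" "G \<subseteq> span B"
    by (rule maximal_independent_subset[of G])
  then have "UNIV \<subseteq> span B" using span_mono[of G "span B"] assms(2) by (simp add: span_span)
  then have "finite_dimensional_vector_space scale B"
    using B assms(1) by unfold_locales (auto intro: finite_subset)
  then show "\<exists>B. finite_dimensional_vector_space scale B" ..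
  show "dim UNIV \<le> card G"
    using assms by (intro dim_le_card) auto
qed

context comm_algebra
begin

section \<open>Bilinear calculus and polynomials evaluated at an operator\<close>

lemma mult_add_right: "x \<cdot> (y + z) = x \<cdot> y + x \<cdot> z"
  by (metis mult_add_left mult_commute)

lemma mult_scale_right: "x \<cdot> (t *s y) = t *s (x \<cdot> y)"
  by (metis mult_scale_left mult_commute)

lemma mult_zero_left [simp]: "0 \<cdot> x = 0"
  using mult_scale_left[of 0 0 x] by simp

lemma mult_zero_right [simp]: "x \<cdot> 0 = 0"
  by (simp add: mult_commute[of x])

lemma mult_diff_left: "(x - y) \<cdot> z = x \<cdot> z - y \<cdot> z"
  by (metis add_diff_cancel diff_add_cancel mult_add_left)

lemma mult_diff_right: "x \<cdot> (y - z) = x \<cdot> y - x \<cdot> z"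
  by (metis mult_diff_left mult_commute)

lemmas bilinear_simps = mult_add_left mult_add_right mult_diff_left mult_diff_right
  mult_scale_left mult_scale_right

lemma in_eigenspace_iff: "x \<in> eigenspace a l \<longleftrightarrow> a \<cdot> x = l *s x"
  by (simp add: eigenspace_def ad_def mult_commute)

lemma subspace_eigenspace: "subspace (eigenspace a l)"
  by (rule subspaceI) (simp_all add: in_eigenspace_iff bilinear_simps scale_right_distrib scale_left_commute)

lemma mult_in_span:
  assumes "\<And>g. g \<in> G \<Longrightarrow> x \<cdot> g \<in> span G" "y \<in> span G"
  shows "x \<cdot> y \<in> span G"
  by (rule linear_image_in_span[OF mult_add_right mult_scale_right assms])

lemma poly_op_eq_sum:
  assumes "degree p \<le> n"
  shows "poly_op p T x = (\<Sum>i\<le>n. coeff p i *s ((T ^^ i) x))"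
  unfolding poly_op_def using assms
  by (intro sum.mono_neutral_left) (auto simp: coeff_eq_0)

lemma poly_op_0 [simp]: "poly_op 0 T x = 0"
  by (simp add: poly_op_def)

lemma poly_op_pCons [simp]: "poly_op (pCons c p) T x = c *s x + poly_op p T (T x)"
proof -
  have "poly_op (pCons c p) T x = (\<Sum>i\<le>Suc (degree p). coeff (pCons c p) i *s ((T ^^ i) x))"
    by (rule poly_op_eq_sum) (simp add: degree_pCons_le)
  also have "\<dots> = c *s x + poly_op p T (T x)"
    unfolding sum.atMost_Suc_shift by (simp add: poly_op_def funpow_swap1)
  finally show ?thesis .
qed

lemma poly_op_add: "poly_op (p + q) T x = poly_op p T x + poly_op q T x"
  by (simp add: poly_op_eq_sum[of _ "max (degree p) (degree q)"] degree_add_le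
      scale_left_distrib sum.distrib)

lemma poly_op_smult: "poly_op (smult c p) T x = c *s poly_op p T x"
  by (simp add: poly_op_eq_sum[of _ "degree p"] degree_smult_le scale_sum_right)

lemma annihilates_dvd:
  assumes "annihilates p T" "p dvd q"
  shows "annihilates q T"
proof -
  obtain r where "q = p * r" using assms(2) by (auto simp: dvd_def)
  moreover have "annihilates (p * r) T"
  proof (induction r)
    case 0
    then show ?case by (simp add: annihilates_def)
  next
    \<comment> \<open>\<open>p * pCons c r\<close> is \<open>smult c p + pCons 0 (p * r)\<close>,
      and the second summand evaluates \<open>p * r\<close> at \<open>T x\<close>; the induction
      hypothesis covers every vector, so also \<open>T x\<close>.\<close>
    case (pCons c r)
    then show ?case using assms(1)
      by (simp add: annihilates_def mult_pCons_right poly_op_add poly_op_smult)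
  qed
  ultimately show ?thesis by simp
qed

end

section \<open>Eigenvectors and fusion rules of one primitive axis\<close>

locale primitive_axis = comm_algebra scale mult
  for scale :: "'k::field \<Rightarrow> 'a::ab_group_add \<Rightarrow> 'a"  (infixr \<open>*s\<close> 75)
    and mult :: "'a \<Rightarrow> 'a \<Rightarrow> 'a"  (infixl \<open>\<cdot>\<close> 70) +
  fixes \<eta> :: 'k and a :: 'a
  assumes eta_nonzero: "\<eta> \<noteq> 0" and eta_not_one: "\<eta> \<noteq> 1"
    and jordan_axis: "jordan_axis \<eta> a"
    and primitive: "primitive a"
begin

abbreviation phi :: "'a \<Rightarrow> 'k" where "phi \<equiv> axis_phi \<eta> a"

lemma idem [simp]: "a \<cdot> a = a"
  using jordan_axis by (simp add: jordan_axis_def idempotent_def)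

lemma axis_nonzero [simp]: "a \<noteq> 0"
proof
  assume "a = 0"
  then have "eigenspace a 1 = {0}" by (auto simp: in_eigenspace_iff)
  \<comment> \<open>An independent subset of the zero space is empty, which would make the dimension
    0 instead of 1.\<close>
  moreover obtain B where "B \<subseteq> eigenspace a 1" "independent B" "card B = dim (eigenspace a 1)"
    by (rule basis_exists[of "eigenspace a 1"])
  ultimately show False
    using primitive dependent_zero by (auto simp: primitive_def subset_singleton_iff)
qed

text \<open>The 1-eigenspace is a line, and the non-zero vector \<open>a\<close> on it can replace
  whatever basis vector \<open>dim\<close> provides.\<close>

lemma eigenvector_1:
  assumes "a \<cdot> x = x"
  obtains t where "x = t *s a"
proof -
  obtain B where B: "B \<subseteq> eigenspace a 1" "eigenspace a 1 \<subseteq> span B" "card B = dim (eigenspace a 1)"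
    by (rule basis_exists[of "eigenspace a 1"])
  then have "card B = 1" using primitive by (simp add: primitive_def)
  then obtain v where v: "B = {v}" by (rule card_1_singletonE)
  have "a \<in> span {v}" "x \<in> span {v}" using B v assms by (auto simp: in_eigenspace_iff)
  then obtain s t where st: "a = s *s v" "x = t *s v" by (auto simp: span_singleton)
  then have "s \<noteq> 0" using axis_nonzero by auto
  then have "x = (t / s) *s a" using st by simp
  then show ?thesis using that by blast
qed

lemma cubic: "a \<cdot> (a \<cdot> (a \<cdot> x)) + \<eta> *s (a \<cdot> x) = (1 + \<eta>) *s (a \<cdot> (a \<cdot> x))"
proof -
  have "annihilates ([:-1, 1:] * [:0, 1:] * [:-\<eta>, 1:]) (ad a)"
    using jordan_axis unfolding jordan_axis_def minimal_polynomial_def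
    by (blast intro: annihilates_dvd)
  also have "[:-1, 1:] * [:0, 1:] * [:-\<eta>, 1:] = [:0, \<eta>, - (1 + \<eta>), 1:]"
    by (simp add: algebra_simps)
  finally have "poly_op [:0, \<eta>, - (1 + \<eta>), 1:] (ad a) x = 0"
    by (simp add: annihilates_def)
  then show ?thesis
    by (simp add: ad_def mult_commute) (simp add: algebra_simps)
qed

lemma zero_zero: "a \<cdot> x = 0 \<Longrightarrow> a \<cdot> y = 0 \<Longrightarrow> a \<cdot> (x \<cdot> y) = 0"
  and zero_eta: "a \<cdot> x = 0 \<Longrightarrow> a \<cdot> z = \<eta> *s z \<Longrightarrow> a \<cdot> (x \<cdot> z) = \<eta> *s (x \<cdot> z)"
proof -
  assume "a \<cdot> x = 0" "a \<cdot> y = 0"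
  then have "x \<cdot> y \<in> prod_set (eigenspace a 0) (eigenspace a 0)"
    by (auto simp: prod_set_def in_eigenspace_iff)
  then show "a \<cdot> (x \<cdot> y) = 0"
    using jordan_axis by (auto simp: jordan_axis_def in_eigenspace_iff subset_iff)
next
  assume x: "a \<cdot> x = 0" and z: "a \<cdot> z = \<eta> *s z"
  have "x + 0 \<in> eigenspace a 0 + eigenspace a 1"
    using x by (intro set_plus_intro) (auto simp: in_eigenspace_iff)
  then have "x \<cdot> z \<in> prod_set (eigenspace a 0 + eigenspace a 1) (eigenspace a \<eta>)"
    using z by (auto simp: prod_set_def in_eigenspace_iff)
  then show "a \<cdot> (x \<cdot> z) = \<eta> *s (x \<cdot> z)"
    using jordan_axis by (auto simp: jordan_axis_def in_eigenspace_iff subset_iff)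
qed

text \<open>By primitivity the 1-component of the product is a multiple of \<open>a\<close>;
  removing it leaves an element of the 0-eigenspace.\<close>

lemma eta_eta:
  assumes "a \<cdot> x = \<eta> *s x" "a \<cdot> y = \<eta> *s y"
  obtains t where "a \<cdot> (x \<cdot> y) = t *s a" "a \<cdot> (x \<cdot> y - t *s a) = 0"
proof -
  have "x \<cdot> y \<in> prod_set (eigenspace a \<eta>) (eigenspace a \<eta>)"
    using assms by (auto simp: prod_set_def in_eigenspace_iff)
  then have "x \<cdot> y \<in> eigenspace a 0 + eigenspace a 1"
    using jordan_axis by (auto simp: jordan_axis_def)
  then obtain v w where vw: "x \<cdot> y = v + w" "a \<cdot> v = 0" "a \<cdot> w = w"
    by (auto simp: in_eigenspace_iff elim!: set_plus_elim)
  moreover obtain t where "w = t *s a" using eigenvector_1 vw(3) .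
  ultimately show ?thesis using that[of t] by (simp add: bilinear_simps)
qed

text \<open>Writing \<open>x = x\<^sub>1 + x\<^sub>0 + x\<^sub>\<eta>\<close>, both sides of the premise have the same components except
  possibly along \<open>a\<close>; thus the quadratic relation pins down \<open>x\<^sub>1\<close>.\<close>

lemma phi_eqI:
  assumes x: "a \<cdot> (a \<cdot> x) = \<eta> *s (a \<cdot> x) + (t * (1 - \<eta>)) *s a"
  shows "phi x = t"
proof -
  \<comment> \<open>\<open>u\<close> is \<eta> times the intended \<eta>-component of
    \<open>x\<close>, so \<open>z\<close> below is what remains as 0-component.\<close>
  define u where "u = a \<cdot> x - t *s a"
  have u: "a \<cdot> u = \<eta> *s u"
    unfolding u_def by (simp add: bilinear_simps x algebra_simps)
  define z where "z = x - t *s a - (1 / \<eta>) *s u"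
  have z: "a \<cdot> z = 0"
    unfolding z_def using eta_nonzero by (simp add: bilinear_simps u) (simp add: u_def)
  have "axis_proj \<eta> a x = t *s a"
    unfolding axis_proj_def
  proof (rule the_equality, intro conjI)
    show "t *s a \<in> eigenspace a 1" by (simp add: in_eigenspace_iff bilinear_simps)
    have "z + (1 / \<eta>) *s u \<in> eigenspace a 0 + eigenspace a \<eta>"
      using u z by (intro set_plus_intro) (auto simp: in_eigenspace_iff bilinear_simps scale_left_commute)
    then show "x - t *s a \<in> eigenspace a 0 + eigenspace a \<eta>" by (simp add: z_def)
  next
    fix p assume "p \<in> eigenspace a 1 \<and> x - p \<in> eigenspace a 0 + eigenspace a \<eta>"
    then obtain v w where vw: "x - p = v + w" "a \<cdot> v = 0" "a \<cdot> w = \<eta> *s w" and p: "a \<cdot> p = p"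
      by (auto simp: in_eigenspace_iff elim!: set_plus_elim)
    obtain s where s: "p = s *s a" using eigenvector_1 p .
    have ex: "x = s *s a + v + w" using vw(1) s by (simp add: algebra_simps)
    \<comment> \<open>For a competing decomposition the premise compares two expressions in which
      \<open>v\<close> drops out and both sides contain the same multiple of \<open>w\<close>; only
      multiples of \<open>a\<close> survive.\<close>
    have "(s * (1 - \<eta>)) *s a = (t * (1 - \<eta>)) *s a"
      using x unfolding ex by (simp add: bilinear_simps vw algebra_simps)
    then show "p = t *s a" using s eta_not_one by simp
  qed
  then show ?thesis by (simp add: axis_phi_def)
qed

text \<open>By \<open>cubic\<close>, multiplication by \<open>a\<close> fixes
  \<open>a \<cdot> (a \<cdot> x) - \<eta> *s (a \<cdot> x)\<close>, so this is a multiple of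
  \<open>a\<close>, and \<open>phi_eqI\<close> identifies the factor. As a rewrite rule it removes
  every repeated multiplication by \<open>a\<close>.\<close>

lemma ad_ad: "a \<cdot> (a \<cdot> x) = \<eta> *s (a \<cdot> x) + (phi x * (1 - \<eta>)) *s a"
proof -
  have "a \<cdot> (a \<cdot> (a \<cdot> x) - \<eta> *s (a \<cdot> x)) = a \<cdot> (a \<cdot> x) - \<eta> *s (a \<cdot> x)"
    using cubic[of x] by (simp add: bilinear_simps algebra_simps)
  then obtain s where s: "a \<cdot> (a \<cdot> x) - \<eta> *s (a \<cdot> x) = s *s a" by (rule eigenvector_1)
  have "a \<cdot> (a \<cdot> x) = \<eta> *s (a \<cdot> x) + (s / (1 - \<eta>) * (1 - \<eta>)) *s a"
    using s eta_not_one by (simp add: diff_eq_eq add.commute)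
  then show ?thesis using phi_eqI by metis
qed

section \<open>The linear form of an axis and the component maps\<close>

lemma phi_add: "phi (x + y) = phi x + phi y"
  by (rule phi_eqI) (simp add: bilinear_simps ad_ad algebra_simps)

lemma phi_scale: "phi (t *s x) = t * phi x"
  by (rule phi_eqI) (simp add: bilinear_simps ad_ad algebra_simps)

lemma phi_diff: "phi (x - y) = phi x - phi y"
  by (metis add_diff_cancel diff_add_cancel phi_add)

lemma phi_axis [simp]: "phi a = 1"
  by (rule phi_eqI) (simp add: algebra_simps)

lemma phi_ad [simp]: "phi (a \<cdot> x) = phi x"
  by (rule phi_eqI) (simp add: bilinear_simps ad_ad algebra_simps)

lemma phi_ad_right [simp]: "phi (x \<cdot> a) = phi x"
  by (simp add: mult_commute[of x])

lemma phi_0: "a \<cdot> x = 0 \<Longrightarrow> phi x = 0"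
  by (rule phi_eqI) simp

lemma phi_eta: "a \<cdot> x = \<eta> *s x \<Longrightarrow> phi x = 0"
  by (rule phi_eqI) (simp add: bilinear_simps)

lemmas phi_simps = phi_add phi_diff phi_scale

text \<open>In terms of \<open>x = x\<^sub>1 + x\<^sub>0 + x\<^sub>\<eta>\<close>: \<open>eta_part x\<close> is \<open>\<eta> x\<^sub>\<eta>\<close> and \<open>zero_part x\<close> is \<open>- \<eta> x\<^sub>0\<close>.\<close>

definition eta_part :: "'a \<Rightarrow> 'a" where "eta_part x = a \<cdot> x - phi x *s a"

definition zero_part :: "'a \<Rightarrow> 'a" where "zero_part x = a \<cdot> x - (phi x * (1 - \<eta>)) *s a - \<eta> *s x"

lemma ad_eta_part: "a \<cdot> eta_part x = \<eta> *s eta_part x"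
  by (simp add: eta_part_def bilinear_simps ad_ad algebra_simps)

lemma ad_zero_part: "a \<cdot> zero_part x = 0"
  by (simp add: zero_part_def bilinear_simps ad_ad algebra_simps)

lemma eta_part_conv: "eta_part x = zero_part x + \<eta> *s (x - phi x *s a)"
  by (simp add: zero_part_def eta_part_def algebra_simps)

lemma zero_part_conv: "zero_part x = eta_part x - \<eta> *s (x - phi x *s a)"
  by (simp add: eta_part_conv)

lemma scale_eta_conv: "\<eta> *s x = eta_part x - zero_part x + (\<eta> * phi x) *s a"
  by (simp add: zero_part_def eta_part_def algebra_simps)

lemma eta_part_add: "eta_part (x + y) = eta_part x + eta_part y"
  and eta_part_scale: "eta_part (t *s x) = t *s eta_part x"
  by (simp_all add: eta_part_def phi_simps bilinear_simps algebra_simps)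

lemma eta_part_diff: "eta_part (x - y) = eta_part x - eta_part y"
  by (metis add_diff_cancel diff_add_cancel eta_part_add)

lemma zero_part_add: "zero_part (x + y) = zero_part x + zero_part y"
  and zero_part_scale: "zero_part (t *s x) = t *s zero_part x"
  by (simp_all add: zero_part_def phi_simps bilinear_simps algebra_simps)

lemma eta_part_of_0: "a \<cdot> x = 0 \<Longrightarrow> eta_part x = 0"
  by (simp add: eta_part_def phi_0)

lemma eta_part_of_eta: "a \<cdot> x = \<eta> *s x \<Longrightarrow> eta_part x = \<eta> *s x"
  by (simp add: eta_part_def phi_eta)

lemma zero_part_of_0: "a \<cdot> x = 0 \<Longrightarrow> zero_part x = (-\<eta>) *s x"
  by (simp add: zero_part_def phi_0)

lemma zero_part_of_eta: "a \<cdot> x = \<eta> *s x \<Longrightarrow> zero_part x = 0"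
  by (simp add: zero_part_def phi_eta)

section \<open>Products of components\<close>

text \<open>Multiplication by an element of the 0-eigenspace preserves the 0- and \<eta>-eigenspaces
  of \<open>a\<close> and kills \<open>a\<close>, so it commutes with multiplication by
  \<open>a\<close>. This is known as the Seress lemma.\<close>

lemma seress:
  assumes z: "a \<cdot> z = 0"
  shows "a \<cdot> (x \<cdot> z) = (a \<cdot> x) \<cdot> z"
proof -
  have "a \<cdot> (zero_part x \<cdot> z) = 0" by (intro zero_zero ad_zero_part z)
  moreover have "a \<cdot> (eta_part x \<cdot> z) = \<eta> *s (eta_part x \<cdot> z)"
    using zero_eta[OF z ad_eta_part[of x]] by (simp add: mult_commute)
  moreover have "\<eta> *s (a \<cdot> (x \<cdot> z)) = a \<cdot> ((\<eta> *s x) \<cdot> z)"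
    by (simp add: mult_scale_left mult_scale_right)
  ultimately have "\<eta> *s (a \<cdot> (x \<cdot> z)) = \<eta> *s (eta_part x \<cdot> z)"
    unfolding scale_eta_conv[of x] using z by (simp add: bilinear_simps)
  then show ?thesis using z eta_nonzero by (simp add: eta_part_def bilinear_simps)
qed

lemma eta_zero: "a \<cdot> z = \<eta> *s z \<Longrightarrow> a \<cdot> x = 0 \<Longrightarrow> a \<cdot> (z \<cdot> x) = \<eta> *s (z \<cdot> x)"
  using zero_eta by (simp add: mult_commute)

text \<open>The 0- and 1-components of \<open>x\<close> multiply \<open>eta_part y\<close> into the
  \<eta>-eigenspace, where \<open>phi\<close> vanishes.\<close>

lemma phi_mult_eta_part: "\<eta> * phi (x \<cdot> eta_part y) = phi (eta_part x \<cdot> eta_part y)"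
proof -
  have "phi (zero_part x \<cdot> eta_part y) = 0" "phi (eta_part y) = 0"
    by (intro phi_eta zero_eta ad_zero_part ad_eta_part)+
  moreover have "\<eta> * phi (x \<cdot> eta_part y) = phi ((\<eta> *s x) \<cdot> eta_part y)"
    by (simp add: bilinear_simps phi_simps)
  ultimately show ?thesis
    unfolding scale_eta_conv[of x] by (simp add: bilinear_simps phi_simps)
qed

text \<open>\<open>phi\<close> vanishes on \<open>zero_part x \<cdot> zero_part y\<close>. Rewriting
  both factors by \<open>zero_part_conv\<close> turns this into an equation in which, by
  \<open>phi_mult_eta_part\<close>, \<open>?t\<close> occurs once with sign plus and twice with sign
  minus.\<close>

lemma phi_eta_part_eta_part:
  "phi (eta_part x \<cdot> eta_part y) = \<eta> * \<eta> * (phi (x \<cdot> y) - phi x * phi y)"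
proof -
  let ?t = "phi (eta_part x \<cdot> eta_part y)"
  have t: "\<eta> * phi (x \<cdot> eta_part y) = ?t" "\<eta> * phi (eta_part x \<cdot> y) = ?t"
    using phi_mult_eta_part[of x y] phi_mult_eta_part[of y x] by (simp_all add: mult_commute)
  have z: "phi (zero_part x \<cdot> zero_part y) = 0" "phi (eta_part x) = 0" "phi (eta_part y) = 0"
    by (intro phi_0 phi_eta zero_zero ad_zero_part ad_eta_part)+
  have conv: "zero_part x \<cdot> zero_part y = (eta_part x - \<eta> *s (x - phi x *s a)) \<cdot>
      (eta_part y - \<eta> *s (y - phi y *s a))"
    by (simp add: eta_part_conv)
  have "phi (zero_part x \<cdot> zero_part y) = ?t - \<eta> * phi (x \<cdot> eta_part y) - \<eta> * phi (eta_part x \<cdot> y)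
      + \<eta> * \<eta> * (phi (x \<cdot> y) - phi x * phi y)"
    unfolding conv using z by (simp add: bilinear_simps phi_simps) (simp add: algebra_simps)
  then show ?thesis using z t by simp
qed

text \<open>For \<open>x = b\<close> and \<open>y = c\<close> this is the last generator of the
  0-eigenspace in the claim.\<close>

definition mixed_zero :: "'a \<Rightarrow> 'a \<Rightarrow> 'a"
  where "mixed_zero x y = x \<cdot> (a \<cdot> y) + y \<cdot> (a \<cdot> x) - \<eta> *s (x \<cdot> y) - (\<eta> * phi x) *s y
    - (\<eta> * phi y) *s x
    - (2 * phi x * phi y + \<eta> * phi (x \<cdot> y) - 4 * \<eta> * phi x * phi y) *s a"

text \<open>In terms of components, \<open>x\<^sub>0 y\<^sub>0\<close> lies in the 0-eigenspace, and so does
  \<open>x\<^sub>\<eta> y\<^sub>\<eta>\<close> up to a multiple of \<open>a\<close>. The products of generators that lie outside the span of the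
  claimed generators cancel in the difference.\<close>

lemma ad_mixed_zero: "a \<cdot> mixed_zero x y = 0"
proof -
  obtain t where t: "a \<cdot> (eta_part x \<cdot> eta_part y - t *s a) = 0"
    using eta_eta[OF ad_eta_part ad_eta_part] by metis
  then have t_eq: "t = \<eta> * \<eta> * (phi (x \<cdot> y) - phi x * phi y)"
    using phi_0[OF t] by (simp add: phi_simps phi_eta_part_eta_part)
  define w where "w = zero_part x \<cdot> zero_part y - (eta_part x \<cdot> eta_part y - t *s a)"
  have w: "a \<cdot> w = 0"
    unfolding w_def mult_diff_right[of a "zero_part x \<cdot> zero_part y"] t
    using zero_zero[OF ad_zero_part ad_zero_part] by simp
  \<comment> \<open>\<open>k\<close> is the coefficient of \<open>a\<close> in
    \<open>mixed_zero x y\<close>, kept opaque during the expansion. The term \<open>l *s a\<close>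
    is what \<open>ad_ad\<close> contributes to \<open>w\<close>, once from
    \<open>a \<cdot> (a \<cdot> x)\<close> and once from
    \<open>a \<cdot> (a \<cdot> y)\<close>.\<close>
  define k where "k = 2 * phi x * phi y + \<eta> * phi (x \<cdot> y) - 4 * \<eta> * phi x * phi y"
  define l where "l = \<eta> * phi x * phi y * (1 - \<eta>)"
  have "\<eta> *s (mixed_zero x y + k *s a)
      = (\<eta> * phi y) *s zero_part x + (\<eta> * phi x) *s zero_part y - w
        + t *s a - (\<eta> * \<eta> * phi x * phi y) *s a + l *s a + l *s a"
    unfolding mixed_zero_def k_def[symmetric] w_def zero_part_conv eta_part_def l_def
    by (simp add: bilinear_simps mult_commute ad_ad) (simp add: algebra_simps)
  moreover have "\<eta> * k = t - \<eta> * \<eta> * phi x * phi y + l + l"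
    unfolding k_def l_def t_eq by (simp add: algebra_simps)
  then have "\<eta> *s (k *s a) = t *s a - (\<eta> * \<eta> * phi x * phi y) *s a + l *s a + l *s a"
    by (simp only: scale_scale scale_left_distrib scale_left_diff_distrib)
  ultimately have "\<eta> *s mixed_zero x y
      = (\<eta> * phi y) *s zero_part x + (\<eta> * phi x) *s zero_part y - w"
    by (simp only: scale_right_distrib) (simp add: algebra_simps)
  then have "a \<cdot> (\<eta> *s mixed_zero x y) = 0"
    using w ad_zero_part by (simp add: bilinear_simps)
  then show ?thesis using eta_nonzero by (simp add: mult_scale_right)
qed

text \<open>The mixed products \<open>x\<^sub>0 y\<^sub>\<eta>\<close> and \<open>x\<^sub>\<eta> y\<^sub>0\<close> lie in the \<open>\<eta>\<close>-eigenspace.\<close>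

lemma ad_mixed_eta:
  "a \<cdot> (x \<cdot> (a \<cdot> y) - y \<cdot> (a \<cdot> x)) = \<eta> *s (x \<cdot> (a \<cdot> y) - y \<cdot> (a \<cdot> x))" (is "a \<cdot> ?d = _")
proof -
  have *: "\<eta> *s ?d = eta_part x \<cdot> zero_part y - zero_part x \<cdot> eta_part y
      + (\<eta> * phi y * (1 - \<eta>)) *s eta_part x - (\<eta> * phi x * (1 - \<eta>)) *s eta_part y"
    unfolding zero_part_def eta_part_def
    by (simp add: bilinear_simps mult_commute ad_ad) (simp add: algebra_simps)
  have "a \<cdot> (\<eta> *s ?d) = \<eta> *s (\<eta> *s ?d)"
    unfolding *
    by (simp add: mult_add_right[of a] mult_diff_right[of a] mult_scale_right[of a]
        eta_zero zero_eta ad_zero_part ad_eta_part)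
      (simp add: algebra_simps)
  then show ?thesis
    using eta_nonzero by (simp add: mult_scale_right scale_scale[symmetric] del: scale_scale)
qed

section \<open>Multipliers of an invariant subspace\<close>

text \<open>\<open>S\<close> is stable under both component maps. Applying \<open>n\<close> to a
  component of \<open>s\<close> and projecting the result isolates single products of a component of
  \<open>n\<close> with a component of \<open>s\<close>. They show that \<open>eta_part n\<close>
  maps \<open>S\<close> into itself, and \<open>a \<cdot> n\<close> differs from
  \<open>eta_part n\<close> by a multiple of \<open>a\<close>.\<close>

lemma multiplier_ad:
  assumes S: "subspace S" "a \<in> S" "\<And>s. s \<in> S \<Longrightarrow> a \<cdot> s \<in> S"
    and n: "\<And>s. s \<in> S \<Longrightarrow> n \<cdot> s \<in> S" and "s \<in> S"
  shows "(a \<cdot> n) \<cdot> s \<in> S"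
proof -
  note closed = subspace_add[OF S(1)] subspace_diff[OF S(1)] subspace_scale[OF S(1)]
  have unscale: "x \<in> S" if "\<eta> *s x \<in> S" for x
    using closed(3)[OF that, of "1 / \<eta>"] eta_nonzero by simp
  have parts: "eta_part x \<in> S" "zero_part x \<in> S" if "x \<in> S" for x
    unfolding eta_part_def zero_part_def using that S by (auto intro: closed)
  let ?c = "\<eta> * phi n"
  have split: "\<eta> *s (n \<cdot> x) = eta_part n \<cdot> x - zero_part n \<cdot> x + ?c *s (a \<cdot> x)" for x
    unfolding mult_scale_left[symmetric] scale_eta_conv[of n] by (simp add: bilinear_simps)
  have 1: "eta_part n \<cdot> zero_part s \<in> S"
  proof -
    \<comment> \<open>In \<open>split\<close>, the product of the two zero parts lies in the
      0-eigenspace and the last term is 0.\<close>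
    have "eta_part (\<eta> *s (n \<cdot> zero_part s)) = \<eta> *s (eta_part n \<cdot> zero_part s)"
      unfolding split
      by (simp add: ad_zero_part eta_part_diff eta_part_of_0 eta_part_of_eta eta_zero ad_eta_part zero_zero)
    then show ?thesis by (metis unscale parts closed(3) n \<open>s \<in> S\<close>)
  qed
  have 2: "eta_part n \<cdot> eta_part s \<in> S"
  proof -
    obtain t where t: "a \<cdot> (eta_part n \<cdot> eta_part s - t *s a) = 0"
      using eta_eta[OF ad_eta_part ad_eta_part] by metis
    \<comment> \<open>A product of two \<eta>-eigenvectors has no \<eta>-component, so projecting
      \<open>n \<cdot> eta_part s\<close> leaves \<open>zero_part n \<cdot> eta_part s\<close> and a
      known vector; \<open>split\<close> then returns the lost product.\<close>
    have "eta_part (eta_part n \<cdot> eta_part s) = 0"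
      using eta_part_of_0[OF t] by (simp add: eta_part_diff eta_part_scale eta_part_def[of a])
    then have "eta_part (\<eta> *s (n \<cdot> eta_part s))
        = \<eta> *s ((\<eta> * ?c) *s eta_part s - zero_part n \<cdot> eta_part s)"
      unfolding split
      by (simp add: eta_part_diff eta_part_add eta_part_scale eta_part_of_eta ad_eta_part zero_eta ad_zero_part)
        (simp add: algebra_simps)
    then have "(\<eta> * ?c) *s eta_part s - zero_part n \<cdot> eta_part s \<in> S"
      by (metis unscale parts closed(3) n \<open>s \<in> S\<close>)
    then have "(\<eta> * ?c) *s eta_part s - ((\<eta> * ?c) *s eta_part s - zero_part n \<cdot> eta_part s) \<in> S"
      by (rule closed(2)[OF closed(3)[OF parts(1)[OF \<open>s \<in> S\<close>]]])
    then have "zero_part n \<cdot> eta_part s \<in> S"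
      by (simp only: diff_diff_eq2 add_diff_cancel_left')
    moreover have "eta_part n \<cdot> eta_part s
        = \<eta> *s (n \<cdot> eta_part s) + zero_part n \<cdot> eta_part s - ?c *s (a \<cdot> eta_part s)"
      unfolding split by simp
    ultimately show ?thesis
      using n parts S(3) \<open>s \<in> S\<close> by (simp only: closed)
  qed
  have "\<eta> *s (eta_part n \<cdot> s)
      = eta_part n \<cdot> eta_part s - eta_part n \<cdot> zero_part s + (\<eta> * phi s) *s (\<eta> *s eta_part n)"
    unfolding mult_scale_right[symmetric, of \<eta> "eta_part n"] scale_eta_conv[of s]
    by (simp add: bilinear_simps mult_commute[of _ a] ad_eta_part)
  \<comment> \<open>Since \<open>a\<close> lies in \<open>S\<close>, so does
    \<open>n \<cdot> a\<close>.\<close>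
  moreover have "eta_part n \<in> S"
    unfolding eta_part_def using n[of a] S(2) by (simp add: mult_commute[of a] closed)
  ultimately have "eta_part n \<cdot> s \<in> S"
    using 1 2 by - (rule unscale, simp only: closed)
  moreover have "(a \<cdot> n) \<cdot> s = eta_part n \<cdot> s + phi n *s (a \<cdot> s)"
    by (simp add: eta_part_def bilinear_simps)
  ultimately show ?thesis using S(3) \<open>s \<in> S\<close> by (simp only: closed)
qed

section \<open>The nine products and the eigenspaces they yield\<close>

text \<open>Up to commutativity the set does not depend on which of the three elements is the axis,
  so each axis can be applied to the same span.\<close>

definition products :: "'a \<Rightarrow> 'a \<Rightarrow> 'a set"
  where "products x y = {a, x, y, a \<cdot> x, x \<cdot> y, a \<cdot> y, (a \<cdot> x) \<cdot> y, (a \<cdot> y) \<cdot> x, (x \<cdot> y) \<cdot> a}"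

text \<open>In characteristic other than two, \<open>(a \<cdot> y) \<cdot> x\<close> and
  \<open>(a \<cdot> x) \<cdot> y\<close> can be traded for their sum and difference. The sum is
  \<open>mixed_zero x y\<close> up to simpler terms, the difference is an \<eta>-eigenvector, so on
  both the maps of interest (multiplication by \<open>a\<close>, \<open>zero_part\<close>,
  \<open>eta_part\<close>) are known.\<close>

lemma image_products_in_span:
  assumes two: "(2::'k) \<noteq> 0"
    and f: "\<And>x y. f (x + y) = f x + f y" "\<And>t x. f (t *s x) = t *s f x"
    and "f a \<in> span Z" "f x \<in> span Z" "f y \<in> span Z" "f (x \<cdot> y) \<in> span Z"
      "f (a \<cdot> x) \<in> span Z" "f (a \<cdot> y) \<in> span Z" "f (a \<cdot> (x \<cdot> y)) \<in> span Z"
      "f (mixed_zero x y) \<in> span Z" "f (x \<cdot> (a \<cdot> y) - y \<cdot> (a \<cdot> x)) \<in> span Z"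
    and "g \<in> products x y"
  shows "f g \<in> span Z"
proof -
  have unscale: "z \<in> span Z" if "2 *s z \<in> span Z" for z
    using span_scale[OF that, of "1 / 2"] two by simp
  have double: "2 *s z = z + z" for z
    using scale_left_distrib[of 1 1 z] by simp
  define k where "k = 2 * phi x * phi y + \<eta> * phi (x \<cdot> y) - 4 * \<eta> * phi x * phi y"
  define d where "d = x \<cdot> (a \<cdot> y) - y \<cdot> (a \<cdot> x)"
  define s where "s = mixed_zero x y + \<eta> *s (x \<cdot> y) + (\<eta> * phi x) *s y + (\<eta> * phi y) *s x + k *s a"
  have s: "s = x \<cdot> (a \<cdot> y) + y \<cdot> (a \<cdot> x)"
    by (simp add: s_def mixed_zero_def k_def)
  have fs: "f s \<in> span Z"
    unfolding s_def f using assms by (intro span_add span_scale)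
  have fd: "f d \<in> span Z" using assms by (simp add: d_def)
  have "2 *s ((a \<cdot> y) \<cdot> x) = s + d" "2 *s ((a \<cdot> x) \<cdot> y) = s + (-1) *s d"
    by (simp_all add: s d_def double mult_commute)
  then have "2 *s f ((a \<cdot> y) \<cdot> x) \<in> span Z" "2 *s f ((a \<cdot> x) \<cdot> y) \<in> span Z"
    unfolding f(2)[symmetric] using fs fd by (simp_all only: f span_add span_scale)
  then have "f ((a \<cdot> y) \<cdot> x) \<in> span Z" "f ((a \<cdot> x) \<cdot> y) \<in> span Z"
    by (blast intro: unscale)+
  then show ?thesis
    using assms by (auto simp: products_def mult_commute[of _ a])
qed

lemma ad_products:
  assumes two: "(2::'k) \<noteq> 0" and "g \<in> products x y"
  shows "a \<cdot> g \<in> span (products x y)"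
proof (rule image_products_in_span[OF two _ _ _ _ _ _ _ _ _ _ _ assms(2)])
  have gens: "a \<in> span (products x y)" "a \<cdot> x \<in> span (products x y)" "a \<cdot> y \<in> span (products x y)"
      "a \<cdot> (x \<cdot> y) \<in> span (products x y)" "x \<cdot> (a \<cdot> y) \<in> span (products x y)"
      "y \<cdot> (a \<cdot> x) \<in> span (products x y)"
    by (auto simp: products_def mult_commute intro: span_base)
  show "a \<cdot> (u + v) = a \<cdot> u + a \<cdot> v" "a \<cdot> (t *s u) = t *s (a \<cdot> u)" for u v t
    by (simp_all add: bilinear_simps)
  show "a \<cdot> a \<in> span (products x y)" "a \<cdot> x \<in> span (products x y)" "a \<cdot> y \<in> span (products x y)"
      "a \<cdot> (x \<cdot> y) \<in> span (products x y)"
    using gens by simp_all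
  show "a \<cdot> (a \<cdot> x) \<in> span (products x y)" "a \<cdot> (a \<cdot> y) \<in> span (products x y)"
      "a \<cdot> (a \<cdot> (x \<cdot> y)) \<in> span (products x y)"
    unfolding ad_ad using gens by (intro span_add span_scale; simp)+
  show "a \<cdot> mixed_zero x y \<in> span (products x y)"
    by (simp add: ad_mixed_zero span_zero)
  show "a \<cdot> (x \<cdot> (a \<cdot> y) - y \<cdot> (a \<cdot> x)) \<in> span (products x y)"
    unfolding ad_mixed_eta using gens by (intro span_diff span_scale)
qed

text \<open>\<open>zero_part\<close> is -\<eta> on the 0-eigenspace, so its values on a spanning set
  span that eigenspace. It vanishes on \<open>a\<close>, on every \<open>a \<cdot> u\<close> and on
  \<eta>-eigenvectors, which leaves four values.\<close>

lemma eigenspace_0_eq_span: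
  assumes two: "(2::'k) \<noteq> 0" and G: "span (products x y) = UNIV"
  shows "eigenspace a 0 = span {zero_part x, zero_part y, zero_part (x \<cdot> y), mixed_zero x y}"
    (is "_ = span ?Z")
proof
  have "?Z \<subseteq> eigenspace a 0"
    by (auto simp: in_eigenspace_iff ad_zero_part ad_mixed_zero)
  then show "span ?Z \<subseteq> eigenspace a 0" by (rule span_minimal) (rule subspace_eigenspace)
  have zero_part_in: "zero_part g \<in> span ?Z" if "g \<in> products x y" for g
  proof (rule image_products_in_span[OF two zero_part_add zero_part_scale _ _ _ _ _ _ _ _ _ that])
    have "zero_part a = 0" "zero_part (a \<cdot> u) = 0" for u
      by (simp_all add: zero_part_def ad_ad algebra_simps)
    then show "zero_part a \<in> span ?Z" "zero_part (a \<cdot> x) \<in> span ?Z" "zero_part (a \<cdot> y) \<in> span ?Z"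
        "zero_part (a \<cdot> (x \<cdot> y)) \<in> span ?Z"
      by (simp_all add: span_zero)
    show "zero_part x \<in> span ?Z" "zero_part y \<in> span ?Z" "zero_part (x \<cdot> y) \<in> span ?Z"
      by (auto intro: span_base)
    show "zero_part (mixed_zero x y) \<in> span ?Z"
      unfolding zero_part_of_0[OF ad_mixed_zero] by (intro span_scale span_base) simp
    show "zero_part (x \<cdot> (a \<cdot> y) - y \<cdot> (a \<cdot> x)) \<in> span ?Z"
      unfolding zero_part_of_eta[OF ad_mixed_eta] by (rule span_zero)
  qed
  show "eigenspace a 0 \<subseteq> span ?Z"
  proof
    fix z assume "z \<in> eigenspace a 0"
    then have "zero_part z = (- \<eta>) *s z" by (simp add: in_eigenspace_iff zero_part_of_0)
    then have "z = (- 1 / \<eta>) *s zero_part z" using eta_nonzero by simp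
    moreover have "zero_part z \<in> span ?Z"
      using G by (intro linear_image_in_span[OF zero_part_add zero_part_scale zero_part_in]) auto
    ultimately show "z \<in> span ?Z" using span_scale by metis
  qed
qed

text \<open>The same argument with \<open>eta_part\<close>, which is \<eta> on the
  \<eta>-eigenspace, vanishes on \<open>a\<close> and on \<open>mixed_zero x y\<close>, and sends
  \<open>a \<cdot> u\<close> to a multiple of \<open>eta_part u\<close>.\<close>

lemma eigenspace_eta_eq_span:
  assumes two: "(2::'k) \<noteq> 0" and G: "span (products x y) = UNIV"
  shows "eigenspace a \<eta>
    = span {x \<cdot> (a \<cdot> y) - y \<cdot> (a \<cdot> x), eta_part x, eta_part y, eta_part (x \<cdot> y)}"
    (is "_ = span ?Z")
proof
  have "?Z \<subseteq> eigenspace a \<eta>"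
    by (auto simp: in_eigenspace_iff ad_eta_part ad_mixed_eta)
  then show "span ?Z \<subseteq> eigenspace a \<eta>" by (rule span_minimal) (rule subspace_eigenspace)
  have eta_part_in: "eta_part g \<in> span ?Z" if "g \<in> products x y" for g
  proof (rule image_products_in_span[OF two eta_part_add eta_part_scale _ _ _ _ _ _ _ _ _ that])
    show "eta_part a \<in> span ?Z" by (simp add: eta_part_def span_zero)
    show *: "eta_part x \<in> span ?Z" "eta_part y \<in> span ?Z" "eta_part (x \<cdot> y) \<in> span ?Z"
      by (auto intro: span_base)
    have "eta_part (a \<cdot> u) = \<eta> *s eta_part u" for u
      by (simp add: eta_part_def ad_ad algebra_simps)
    then show "eta_part (a \<cdot> x) \<in> span ?Z" "eta_part (a \<cdot> y) \<in> span ?Z"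
        "eta_part (a \<cdot> (x \<cdot> y)) \<in> span ?Z"
      using * by (simp_all add: span_scale)
    show "eta_part (mixed_zero x y) \<in> span ?Z"
      unfolding eta_part_of_0[OF ad_mixed_zero] by (rule span_zero)
    show "eta_part (x \<cdot> (a \<cdot> y) - y \<cdot> (a \<cdot> x)) \<in> span ?Z"
      unfolding eta_part_of_eta[OF ad_mixed_eta] by (intro span_scale span_base) simp
  qed
  show "eigenspace a \<eta> \<subseteq> span ?Z"
  proof
    fix z assume "z \<in> eigenspace a \<eta>"
    then have "eta_part z = \<eta> *s z" by (simp add: in_eigenspace_iff eta_part_of_eta)
    then have "z = (1 / \<eta>) *s eta_part z" using eta_nonzero by simp
    moreover have "eta_part z \<in> span ?Z"
      using G by (intro linear_image_in_span[OF eta_part_add eta_part_scale eta_part_in]) auto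
    ultimately show "z \<in> span ?Z" using span_scale by metis
  qed
qed

end

section \<open>Two primitive axes\<close>

text \<open>The element \<sigma> is symmetric in the axes and, for each of them, a multiple of the
  axis plus a 0-eigenvector. By \<open>seress\<close> for both axes,
  \<open>a \<cdot> (b \<cdot> \<sigma>)\<close> and \<open>b \<cdot> (a \<cdot> \<sigma>)\<close>
  equal \<open>(a \<cdot> b) \<cdot> \<sigma>\<close>, and comparing them gives \<open>l = k\<close>
  unless \<open>a \<cdot> b = 0\<close>.\<close>

lemma (in comm_algebra) phi_sym:
  assumes "primitive_axis scale mult \<eta> a" "primitive_axis scale mult \<eta> b"
  shows "axis_phi \<eta> a b = axis_phi \<eta> b a"
proof -
  interpret A: primitive_axis scale mult \<eta> a by fact
  interpret B: primitive_axis scale mult \<eta> b by fact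
  define \<sigma> where "\<sigma> = a \<cdot> b - \<eta> *s a - \<eta> *s b"
  define k where "k = A.phi b * (1 - \<eta>) - \<eta>"
  define l where "l = B.phi a * (1 - \<eta>) - \<eta>"
  have \<sigma>: "\<sigma> = k *s a + A.zero_part b" "\<sigma> = l *s b + B.zero_part a"
    by (simp_all add: \<sigma>_def k_def l_def A.zero_part_def B.zero_part_def mult_commute[of b a] algebra_simps)
  have ev: "a \<cdot> \<sigma> = k *s a" "b \<cdot> \<sigma> = l *s b"
    by (simp add: \<sigma>(1) bilinear_simps A.ad_zero_part, simp add: \<sigma>(2) bilinear_simps B.ad_zero_part)
  have "a \<cdot> (b \<cdot> \<sigma>) = (a \<cdot> b) \<cdot> \<sigma>" "b \<cdot> (a \<cdot> \<sigma>) = (b \<cdot> a) \<cdot> \<sigma>"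
    by (simp add: \<sigma>(1) bilinear_simps A.seress[OF A.ad_zero_part] mult_commute[of "a \<cdot> b" a] mult_commute[of b a],
        simp add: \<sigma>(2) bilinear_simps B.seress[OF B.ad_zero_part] mult_commute[of "b \<cdot> a" b] mult_commute[of a b])
  then have eq: "l *s (a \<cdot> b) = k *s (a \<cdot> b)"
    by (simp add: ev bilinear_simps mult_commute[of b a])
  show ?thesis
  proof (cases "a \<cdot> b = 0")
    case True
    then have "A.phi b = 0" "B.phi a = 0"
      by (simp_all add: A.phi_0 B.phi_0 mult_commute[of b a])
    then show ?thesis by simp
  next
    case False
    then have "l = k" using eq by simp
    then show ?thesis using A.eta_not_one by (simp add: k_def l_def)
  qed
qed

text \<open>With \<open>u = eta_part b\<close>, the fusion rule makes
  \<open>a \<cdot> (u \<cdot> u)\<close> a multiple of \<open>a\<close>. Expanding it yields another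
  multiple of \<open>a\<close> plus \<open>?\<kappa> *s (a \<cdot> b)\<close>, and the hypotheses
  make \<open>?\<kappa>\<close> non-zero.\<close>

lemma (in primitive_axis) ad_axis_dichotomy:
  assumes "primitive_axis scale mult \<eta> b" "2 * \<eta> \<noteq> 1" "2 * phi b \<noteq> \<eta>"
  shows "a \<cdot> b = phi b *s a"
proof -
  interpret B: primitive_axis scale mult \<eta> b by fact
  define \<alpha> k p u where "\<alpha> = phi b" and "k = \<alpha> * (1 - \<eta>) - \<eta>"
    and "p = zero_part b" and "u = eta_part b"
  have \<alpha>: "B.phi a = \<alpha>"
    unfolding \<alpha>_def by (rule phi_sym) unfold_locales
  have p: "a \<cdot> p = 0" unfolding p_def by (rule ad_zero_part)
  \<comment> \<open>Both sides are \<open>a \<cdot> b - \<eta> *s a - \<eta> *s b - k *s a\<close>.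
    By \<open>phi_sym\<close> the same \<open>k\<close> serves for both axes, and \<open>b\<close>
    kills \<open>B.zero_part a\<close>, so \<open>b \<cdot> p\<close> becomes computable.\<close>
  have "p = k *s b + B.zero_part a - k *s a"
    by (simp add: p_def k_def \<alpha> \<alpha>_def[symmetric] zero_part_def B.zero_part_def mult_commute[of b a] algebra_simps)
  then have bp: "b \<cdot> p = k *s b - k *s (a \<cdot> b)"
    by (simp add: bilinear_simps B.ad_zero_part mult_commute[of b a])
  have u: "u = p + \<eta> *s (b - \<alpha> *s a)"
    unfolding u_def p_def \<alpha>_def by (rule eta_part_conv)
  have uu: "u \<cdot> u = p \<cdot> p + \<eta> *s (b \<cdot> p) + \<eta> *s (b \<cdot> p)
      + (\<eta> * \<eta>) *s (b - \<alpha> *s (a \<cdot> b) - \<alpha> *s (a \<cdot> b) + (\<alpha> * \<alpha>) *s a)"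
    unfolding u by (simp add: bilinear_simps p mult_commute[of p a] mult_commute[of p b] mult_commute[of b a])
      (simp add: algebra_simps)
  obtain t where t: "a \<cdot> (u \<cdot> u) = t *s a"
    unfolding u_def by (rule eta_eta[OF ad_eta_part ad_eta_part])
  define e f h i where "e = \<eta> * k * (1 - \<eta>)" and "f = \<eta> * \<eta> * \<alpha> * \<eta>"
    and "h = \<eta> * k * \<alpha> * (1 - \<eta>)" and "i = \<eta> * \<eta> * \<alpha> * \<alpha> * (1 - \<eta>)"
  have "e *s (a \<cdot> b) + e *s (a \<cdot> b) + (\<eta> * \<eta>) *s (a \<cdot> b) - f *s (a \<cdot> b) - f *s (a \<cdot> b)
      = t *s a + h *s a + h *s a + i *s a + i *s a - (\<eta> * \<eta> * \<alpha> * \<alpha>) *s a"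
    unfolding t[symmetric] uu bp e_def f_def h_def i_def
    by (simp add: bilinear_simps ad_ad \<alpha>_def[symmetric] zero_zero p) (simp add: algebra_simps)
  then have eq: "(e + e + \<eta> * \<eta> - f - f) *s (a \<cdot> b)
      = (t + h + h + i + i - \<eta> * \<eta> * \<alpha> * \<alpha>) *s a" (is "?\<kappa> *s _ = ?m *s _")
    by (simp only: scale_left_distrib scale_left_diff_distrib)
  have "?\<kappa> = \<eta> * ((1 - 2 * \<eta>) * (2 * \<alpha> - \<eta>))"
    by (simp add: e_def f_def k_def algebra_simps)
  then have "?\<kappa> \<noteq> 0" using eta_nonzero assms(2,3) by (simp add: \<alpha>_def)
  then have "a \<cdot> b = (?m / ?\<kappa>) *s a"
    using arg_cong[OF eq, of "\<lambda>v. (1 / ?\<kappa>) *s v"] by simp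
  then obtain r where ab: "a \<cdot> b = r *s a" ..
  have "phi b = r"
    by (rule phi_eqI) (simp add: ab bilinear_simps algebra_simps)
  then show ?thesis using ab by simp
qed

text \<open>Used from both sides, \<open>ad_axis_dichotomy\<close> equates
  \<open>a \<cdot> b\<close> with a multiple of \<open>a\<close> and of \<open>b\<close>; by
  \<open>phi_sym\<close> the factors agree.\<close>

lemma (in comm_algebra) axes_trichotomy:
  assumes "primitive_axis scale mult \<eta> a" "primitive_axis scale mult \<eta> b"
    and "2 * \<eta> \<noteq> 1" "2 * axis_phi \<eta> a b \<noteq> \<eta>" "axis_phi \<eta> a b \<noteq> 0"
  shows "a = b"
proof -
  have "axis_phi \<eta> a b *s a = axis_phi \<eta> a b *s b"
    using primitive_axis.ad_axis_dichotomy[OF assms(1-4)]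
      primitive_axis.ad_axis_dichotomy[OF assms(2,1,3)] assms(4) phi_sym[OF assms(1,2)]
    by (metis mult_commute)
  then show ?thesis using assms(5) by simp
qed

section \<open>Three generating axes\<close>

lemma (in comm_algebra) span_products_eq_UNIV:
  fixes \<eta> :: 'k
  assumes two: "(2::'k) \<noteq> 0"
    and a: "primitive_axis scale mult \<eta> a"
    and b: "primitive_axis scale mult \<eta> b"
    and c: "primitive_axis scale mult \<eta> c"
    and gen: "generated_by {a, b, c}"
  shows "span {a, b, c, a \<cdot> b, b \<cdot> c, a \<cdot> c, (a \<cdot> b) \<cdot> c, (a \<cdot> c) \<cdot> b, (b \<cdot> c) \<cdot> a} = UNIV"
    (is "span ?G = UNIV")
proof -
  interpret A: primitive_axis scale mult \<eta> a by fact
  interpret B: primitive_axis scale mult \<eta> b by fact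
  interpret C: primitive_axis scale mult \<eta> c by fact
  let ?S = "span ?G"
  have G: "?G = A.products b c" "?G = B.products a c" "?G = C.products a b"
    by (auto simp: A.products_def B.products_def C.products_def mult_commute)
  have ad: "a \<cdot> s \<in> ?S" "b \<cdot> s \<in> ?S" "c \<cdot> s \<in> ?S" if "s \<in> ?S" for s
  proof -
    show "a \<cdot> s \<in> ?S"
      using A.ad_products[OF two] that unfolding G(1) by (rule mult_in_span)
    show "b \<cdot> s \<in> ?S"
      using B.ad_products[OF two] that unfolding G(2) by (rule mult_in_span)
    show "c \<cdot> s \<in> ?S"
      using C.ad_products[OF two] that unfolding G(3) by (rule mult_in_span)
  qed
  \<comment> \<open>Without associativity, invariance of \<open>?S\<close> under the generators does
    not yet make it closed under products; what is missing is that \<open>?S\<close> lies in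
    \<open>N\<close>.\<close>
  define N where "N = {n. \<forall>s\<in>?S. n \<cdot> s \<in> ?S}"
  have "subspace N"
    by (rule subspaceI) (auto simp: N_def bilinear_simps span_zero span_add span_scale)
  have axes: "a \<in> N" "b \<in> N" "c \<in> N" "a \<in> ?S" "b \<in> ?S" "c \<in> ?S"
    using ad by (auto simp: N_def intro: span_base)
  have step: "a \<cdot> n \<in> N" "b \<cdot> n \<in> N" "c \<cdot> n \<in> N" if "n \<in> N" for n
  proof -
    have n: "n \<cdot> s \<in> ?S" if "s \<in> ?S" for s
      using that \<open>n \<in> N\<close> by (simp add: N_def)
    have "(a \<cdot> n) \<cdot> s \<in> ?S" "(b \<cdot> n) \<cdot> s \<in> ?S" "(c \<cdot> n) \<cdot> s \<in> ?S" if "s \<in> ?S" for s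
      by (rule A.multiplier_ad[OF subspace_span axes(4) ad(1) n that]
          B.multiplier_ad[OF subspace_span axes(5) ad(2) n that]
          C.multiplier_ad[OF subspace_span axes(6) ad(3) n that]; assumption)+
    then show "a \<cdot> n \<in> N" "b \<cdot> n \<in> N" "c \<cdot> n \<in> N"
      unfolding N_def by blast+
  qed
  have "(a \<cdot> b) \<cdot> c \<in> N" "(a \<cdot> c) \<cdot> b \<in> N" "(b \<cdot> c) \<cdot> a \<in> N"
    using axes step by (metis mult_commute)+
  then have "?G \<subseteq> N" using axes step by simp
  then have "?S \<subseteq> N" using \<open>subspace N\<close> by (rule span_minimal)
  then have "subalgebra ?S" by (auto simp: subalgebra_def N_def)
  moreover have "{a, b, c} \<subseteq> ?S" using axes by simp
  ultimately have "subalgebra hull {a, b, c} \<subseteq> ?S" by (intro hull_minimal)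
  then show ?thesis using gen by (simp add: generated_by_def top.extremum_unique)
qed

theorem theorem1:
  fixes scale :: "'k::field \<Rightarrow> 'a::ab_group_add \<Rightarrow> 'a"  (infixr \<open>*s\<close> 75)
    and mult :: "'a \<Rightarrow> 'a \<Rightarrow> 'a"  (infixl \<open>\<cdot>\<close> 70)
    and \<eta> \<alpha> \<beta> \<gamma> \<psi> :: 'k
    and a b c :: 'a
  assumes "CHAR('k) \<noteq> 2"
    and "\<eta> \<noteq> 0" and "\<eta> \<noteq> 1"
    and "comm_algebra scale mult"
    and "comm_algebra.axial_jordan_generated scale mult \<eta> {a, b, c}"
    and "comm_algebra.primitive scale mult a"
    and "comm_algebra.primitive scale mult b"
    and "comm_algebra.primitive scale mult c"
    and "\<alpha> = comm_algebra.axis_phi scale mult \<eta> a b"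
    and "\<beta> = comm_algebra.axis_phi scale mult \<eta> b c"
    and "\<gamma> = comm_algebra.axis_phi scale mult \<eta> c a"
    and "\<psi> = comm_algebra.axis_phi scale mult \<eta> a (b \<cdot> c)"
  shows "module.span scale
      {a, b, c, a \<cdot> b, b \<cdot> c, a \<cdot> c, (a \<cdot> b) \<cdot> c, (a \<cdot> c) \<cdot> b, (b \<cdot> c) \<cdot> a} = UNIV
    \<and> (\<exists>B. finite_dimensional_vector_space scale B)
    \<and> vector_space.dim scale (UNIV :: 'a set) \<le> 9
    \<and> comm_algebra.eigenspace scale mult a 0 = module.span scale
      {a \<cdot> b - (\<alpha> * (1 - \<eta>)) *s a - \<eta> *s b,
       a \<cdot> c - (\<gamma> * (1 - \<eta>)) *s a - \<eta> *s c,
       a \<cdot> (b \<cdot> c) - \<eta> *s (b \<cdot> c) - (\<psi> * (1 - \<eta>)) *s a,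
       b \<cdot> (a \<cdot> c) + c \<cdot> (a \<cdot> b) - \<eta> *s (b \<cdot> c) - (\<eta> * \<alpha>) *s c - (\<eta> * \<gamma>) *s b
         - (2 * \<alpha> * \<gamma> + \<eta> * \<psi> - 4 * \<eta> * \<alpha> * \<gamma>) *s a}
    \<and> comm_algebra.eigenspace scale mult a \<eta> = module.span scale
      {b \<cdot> (a \<cdot> c) - c \<cdot> (a \<cdot> b),
       a \<cdot> b - \<alpha> *s a,
       a \<cdot> c - \<gamma> *s a,
       a \<cdot> (b \<cdot> c) - \<psi> *s a}
    \<and> (\<eta> = 1 / 2 \<or>
      (\<alpha> * (\<beta> - \<gamma>) * (\<eta> - 2 * \<alpha>) = 0 \<and>
       \<beta> * (\<gamma> - \<alpha>) * (\<eta> - 2 * \<beta>) = 0 \<and>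
       \<gamma> * (\<alpha> - \<beta>) * (\<eta> - 2 * \<gamma>) = 0))"
proof -
  interpret comm_algebra scale mult by fact
  have two: "(2::'k) \<noteq> 0"
  proof
    assume "(2::'k) = 0"
    then have "CHAR('k) dvd 2" using of_nat_eq_0_iff_char_dvd[of 2, where 'a = 'k] by simp
    \<comment> \<open>The value 1 is impossible in a field, because 1 differs from 0.\<close>
    then have "CHAR('k) = 1 \<or> CHAR('k) = 2" using two_is_prime_nat by (metis prime_nat_iff)
    then show False using assms(1) by simp
  qed
  have gen: "generated_by {a, b, c}" and axes: "\<And>x. x \<in> {a, b, c} \<Longrightarrow> jordan_axis \<eta> x"
    using assms(5) by (auto simp: axial_jordan_generated_def)
  interpret A: primitive_axis scale mult \<eta> a
    using assms(2,3,6) axes by unfold_locales auto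
  interpret B: primitive_axis scale mult \<eta> b
    using assms(2,3,7) axes by unfold_locales auto
  interpret C: primitive_axis scale mult \<eta> c
    using assms(2,3,8) axes by unfold_locales auto
  note axs = A.primitive_axis_axioms B.primitive_axis_axioms C.primitive_axis_axioms
  let ?G = "{a, b, c, a \<cdot> b, b \<cdot> c, a \<cdot> c, (a \<cdot> b) \<cdot> c, (a \<cdot> c) \<cdot> b, (b \<cdot> c) \<cdot> a}"
  have G: "span ?G = UNIV" by (rule span_products_eq_UNIV[OF two axs gen])
  have "card ?G \<le> 9"
    using card_length[of "[a, b, c, a \<cdot> b, b \<cdot> c, a \<cdot> c, (a \<cdot> b) \<cdot> c, (a \<cdot> c) \<cdot> b, (b \<cdot> c) \<cdot> a]"]
    by simp
  then have dim: "\<exists>B. finite_dimensional_vector_space scale B" "dim UNIV \<le> 9"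
    using finite_span_imp[OF _ G] by auto
  have phi: "A.phi b = \<alpha>" "B.phi c = \<beta>" "C.phi a = \<gamma>" "A.phi (b \<cdot> c) = \<psi>"
    by (simp_all add: assms)
  have sym: "B.phi a = \<alpha>" "C.phi b = \<beta>" "A.phi c = \<gamma>"
    using phi phi_sym axs by metis+
  have products: "span (A.products b c) = UNIV" using G by (simp add: A.products_def)
  \<comment> \<open>\<open>zero_part (b \<cdot> c)\<close> subtracts the multiple of
    \<open>a\<close> first, the claim subtracts the multiple of \<open>b \<cdot> c\<close>
    first.\<close>
  have swap: "u - v - w = u - w - v" for u v w :: 'a by simp
  have E0: "eigenspace a 0 = span
      {a \<cdot> b - (\<alpha> * (1 - \<eta>)) *s a - \<eta> *s b,
       a \<cdot> c - (\<gamma> * (1 - \<eta>)) *s a - \<eta> *s c,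
       a \<cdot> (b \<cdot> c) - \<eta> *s (b \<cdot> c) - (\<psi> * (1 - \<eta>)) *s a,
       b \<cdot> (a \<cdot> c) + c \<cdot> (a \<cdot> b) - \<eta> *s (b \<cdot> c) - (\<eta> * \<alpha>) *s c - (\<eta> * \<gamma>) *s b
         - (2 * \<alpha> * \<gamma> + \<eta> * \<psi> - 4 * \<eta> * \<alpha> * \<gamma>) *s a}"
    using A.eigenspace_0_eq_span[OF two products]
    unfolding A.zero_part_def A.mixed_zero_def phi sym
    by (simp only: swap[of "a \<cdot> (b \<cdot> c)"])
  have Eeta: "eigenspace a \<eta> = span
      {b \<cdot> (a \<cdot> c) - c \<cdot> (a \<cdot> b), a \<cdot> b - \<alpha> *s a, a \<cdot> c - \<gamma> *s a, a \<cdot> (b \<cdot> c) - \<psi> *s a}"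
    using A.eigenspace_eta_eq_span[OF two products]
    unfolding A.eta_part_def phi sym .
  have "\<alpha> * (\<beta> - \<gamma>) * (\<eta> - 2 * \<alpha>) = 0 \<and> \<beta> * (\<gamma> - \<alpha>) * (\<eta> - 2 * \<beta>) = 0
      \<and> \<gamma> * (\<alpha> - \<beta>) * (\<eta> - 2 * \<gamma>) = 0" if "\<eta> \<noteq> 1 / 2"
  proof -
    have half: "2 * \<eta> \<noteq> 1" using that two by (auto simp: field_simps)
    \<comment> \<open>If neither outer factor is zero, \<open>axes_trichotomy\<close> identifies two
      of the axes, and the two remaining parameters then coincide by symmetry of the forms.\<close>
    have vanish: "x * (y - z) * (\<eta> - 2 * x) = 0" if "2 * x \<noteq> \<eta> \<Longrightarrow> x \<noteq> 0 \<Longrightarrow> y = z" for x y z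
      using that by (cases "2 * x = \<eta>"; cases "x = 0") simp_all
    have "\<alpha> * (\<beta> - \<gamma>) * (\<eta> - 2 * \<alpha>) = 0"
    proof (rule vanish)
      assume "2 * \<alpha> \<noteq> \<eta>" "\<alpha> \<noteq> 0"
      then have "a = b" using axes_trichotomy[OF axs(1,2) half] phi by simp
      then show "\<beta> = \<gamma>" using phi sym by simp
    qed
    moreover have "\<beta> * (\<gamma> - \<alpha>) * (\<eta> - 2 * \<beta>) = 0"
    proof (rule vanish)
      assume "2 * \<beta> \<noteq> \<eta>" "\<beta> \<noteq> 0"
      then have "b = c" using axes_trichotomy[OF axs(2,3) half] phi by simp
      then show "\<gamma> = \<alpha>" using phi sym by simp
    qed
    moreover have "\<gamma> * (\<alpha> - \<beta>) * (\<eta> - 2 * \<gamma>) = 0"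
    proof (rule vanish)
      assume "2 * \<gamma> \<noteq> \<eta>" "\<gamma> \<noteq> 0"
      then have "c = a" using axes_trichotomy[OF axs(3,1) half] phi by simp
      then show "\<alpha> = \<beta>" using phi sym by simp
    qed
    ultimately show ?thesis by (intro conjI)
  qed
  then show ?thesis using G dim E0 Eeta by blast
qed

end
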